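(* A permutation $\pi\in B_n$ is a signed arc permutation if and only if it avoids the following $24$ patterns (each $\pm$ ranging independently over both signs): $$[\pm1,-2,\pm3],\ [\pm1,3,\pm2],\ [\pm2,-3,\pm1],\ [\pm2,1,\pm3],\ [\pm3,-1,\pm2],\ [\pm3,2,\pm1].$$
   Context: $B_n$ is the group of bijections $\pi$ of $\{\pm1,\dots,\pm n\}$ with $\pi(-a)=-\pi(a)$, written $\pi=[\pi(1),\dots,\pi(n)]$. An interval of $\mathbb{Z}_n$ is a set of the form $\{a,a+1,\dots,b\}$ or $\{b,b+1,\dots,n,1,2,\dots,a\}$ with $1\le a\le b\le n$. A permutation $\pi\in B_n$ is a signed arc permutation if for every $1<i<n$: (1) $\{|\pi(1)|,\dots,|\pi(i)|\}$ is an interval of $\mathbb{Z}_n$; and (2) $\pi(i)>0$ if $|\pi(i)|-1\in\{|\pi(1)|,\dots,|\pi(i-1)|\}$ and $\pi(i)<0$ if $|\pi(i)|+1\in\{|\pi(1)|,\dots,|\pi(i-1)|\}$, with arithmetic in $\mathbb{Z}_n$ (values in $\{1,\dots,n\}$); no restriction on the signs of $\pi(1),\pi(n)$. Pattern containment: $\pi\in B_n$ contains $\sigma\in B_k$ if there are indices $i_1<\dots<i_k$ such that $\pi(i_j)$ and $\sigma(j)$ have the same sign for all $j$ and $|\pi(i_1)|\cdots|\pi(i_k)|$ is in the same relative order as $|\sigma(1)|\cdots|\sigma(k)|$; otherwise $\pi$ avoids $\sigma$. *)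

theory Defs
  imports Main "HOL-Combinatorics.Permutations"
begin

definition pm_set :: "nat \<Rightarrow> int set" where
  "pm_set n = {1..int n} \<union> {- int n..-1}"

text \<open>
  An element of \<open>B\<^sub>n\<close> is a function on all of \<open>int\<close>; \<open>permutes\<close> makes it the identity outside
  \<open>{\<plusminus>1, \<dots>, \<plusminus>n}\<close>, so that equality of such functions is equality in \<open>B\<^sub>n\<close>.
\<close>

definition signed_perms :: "nat \<Rightarrow> (int \<Rightarrow> int) set" where
  "signed_perms n = {\<pi>. \<pi> permutes pm_set n \<and> (\<forall>a\<in>pm_set n. \<pi> (- a) = - \<pi> a)}"

text \<open>The signed permutation \<open>[\<pi>(1), \<dots>, \<pi>(n)]\<close> given in window notation.\<close>

definition of_window :: "int list \<Rightarrow> int \<Rightarrow> int" where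
  "of_window ws a =
     (if 1 \<le> a \<and> a \<le> int (length ws) then ws ! nat (a - 1)
      else if - int (length ws) \<le> a \<and> a \<le> -1 then - (ws ! nat (- a - 1))
      else a)"

definition cyclic_interval :: "nat \<Rightarrow> int set \<Rightarrow> bool" where
  "cyclic_interval n A \<longleftrightarrow>
     (\<exists>a b. 1 \<le> a \<and> a \<le> b \<and> b \<le> int n \<and> (A = {a..b} \<or> A = {b..int n} \<union> {1..a}))"

text \<open>The representative in \<open>{1, \<dots>, n}\<close> of the residue class of \<open>x\<close> modulo \<open>n\<close>.\<close>

definition cyc :: "nat \<Rightarrow> int \<Rightarrow> int" where
  "cyc n x = (x - 1) mod int n + 1"

definition signed_arc_perm :: "nat \<Rightarrow> (int \<Rightarrow> int) \<Rightarrow> bool" where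
  "signed_arc_perm n \<pi> \<longleftrightarrow>
     \<pi> \<in> signed_perms n \<and>
     (\<forall>i. 1 < i \<and> i < int n \<longrightarrow>
        cyclic_interval n ((\<lambda>j. \<bar>\<pi> j\<bar>) ` {1..i}) \<and>
        (cyc n (\<bar>\<pi> i\<bar> - 1) \<in> (\<lambda>j. \<bar>\<pi> j\<bar>) ` {1..i - 1} \<longrightarrow> \<pi> i > 0) \<and>
        (cyc n (\<bar>\<pi> i\<bar> + 1) \<in> (\<lambda>j. \<bar>\<pi> j\<bar>) ` {1..i - 1} \<longrightarrow> \<pi> i < 0))"

text \<open>\<open>contains_pattern n \<pi> k \<sigma>\<close>: the element \<open>\<pi>\<close> of \<open>B\<^sub>n\<close> contains the pattern \<open>\<sigma>\<close> of \<open>B\<^sub>k\<close>.\<close>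

definition contains_pattern :: "nat \<Rightarrow> (int \<Rightarrow> int) \<Rightarrow> nat \<Rightarrow> (int \<Rightarrow> int) \<Rightarrow> bool" where
  "contains_pattern n \<pi> k \<sigma> \<longleftrightarrow>
     (\<exists>ix :: int \<Rightarrow> int.
        strict_mono_on {1..int k} ix \<and> ix ` {1..int k} \<subseteq> {1..int n} \<and>
        (\<forall>j\<in>{1..int k}. sgn (\<pi> (ix j)) = sgn (\<sigma> j)) \<and>
        (\<forall>j\<in>{1..int k}. \<forall>l\<in>{1..int k}. \<bar>\<pi> (ix j)\<bar> < \<bar>\<pi> (ix l)\<bar> \<longleftrightarrow> \<bar>\<sigma> j\<bar> < \<bar>\<sigma> l\<bar>))"

abbreviation avoids_pattern :: "nat \<Rightarrow> (int \<Rightarrow> int) \<Rightarrow> nat \<Rightarrow> (int \<Rightarrow> int) \<Rightarrow> bool" where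
  "avoids_pattern n \<pi> k \<sigma> \<equiv> \<not> contains_pattern n \<pi> k \<sigma>"

definition arc_patterns :: "(int \<Rightarrow> int) set" where
  "arc_patterns = (\<Union>s\<in>{1, -1}. \<Union>t\<in>{1, -1}. of_window `
     {[s * 1, -2, t * 3], [s * 1, 3, t * 2], [s * 2, -3, t * 1],
      [s * 2, 1, t * 3], [s * 3, -1, t * 2], [s * 3, 2, t * 1]})"

lemma pm_set_3: "pm_set 3 = {1, 2, 3, -1, -2, -3}"
  by (auto simp: pm_set_def)

lemma of_window_3:
  "of_window [x, y, z] = id(1 := x, 2 := y, 3 := z, -1 := - x, -2 := - y, -3 := - z)"
proof
  fix a :: int
  consider "a \<in> {1, 2, 3, -1, -2, -3}" | "a > 3 \<or> a < -3 \<or> a = 0" by force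
  then show "of_window [x, y, z] a =
      (id(1 := x, 2 := y, 3 := z, -1 := - x, -2 := - y, -3 := - z)) a"
    by cases (auto simp: of_window_def numeral_2_eq_2)
qed

lemma of_window_3_inject: "of_window [x, y, z] = of_window [x', y', z'] \<longleftrightarrow> [x, y, z] = [x', y', z']"
proof
  assume "of_window [x, y, z] = of_window [x', y', z']"
  then have "of_window [x, y, z] a = of_window [x', y', z'] a" for a by simp
  from this[of 1] this[of 2] this[of 3] show "[x, y, z] = [x', y', z']"
    by (simp add: of_window_3)
qed auto

lemma arc_patterns_subset: "arc_patterns \<subseteq> signed_perms 3"
proof -
  have *: "of_window [x, y, z] \<in> signed_perms 3"
    if "(\<lambda>a. of_window [x, y, z] a) ` pm_set 3 = pm_set 3" for x y z
  proof -
    let ?f = "of_window [x, y, z]"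
    have fin: "finite (pm_set 3)" by (simp add: pm_set_3)
    have "inj_on ?f (pm_set 3)" using that fin by (simp add: eq_card_imp_inj_on)
    then have "bij_betw ?f (pm_set 3) (pm_set 3)" using that by (simp add: bij_betw_def)
    moreover have "?f a = a" if "a \<notin> pm_set 3" for a
      using that by (simp add: pm_set_3 of_window_3)
    ultimately have "?f permutes pm_set 3" by (rule bij_imp_permutes)
    moreover have "\<forall>a\<in>pm_set 3. ?f (- a) = - ?f a" by (simp add: pm_set_3 of_window_3)
    ultimately show ?thesis by (simp add: signed_perms_def)
  qed
  show ?thesis
    unfolding arc_patterns_def
    by (simp, intro conjI; rule *; simp add: pm_set_3 of_window_3; blast)
qed

lemma card_arc_patterns: "card arc_patterns = 24"
  unfolding arc_patterns_def by (simp add: of_window_3_inject)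

end

theory Submission
  imports Defs
begin

text \<open>
  The forbidden patterns say exactly this: for positions \<open>i < j < k\<close> the sign of \<open>\<pi>(j)\<close> is the
  orientation of the triple \<open>|\<pi>(i)|, |\<pi>(j)|, |\<pi>(k)|\<close> on the circle. Let \<open>A\<close> be the set of the
  values before position \<open>j\<close> and \<open>b = |\<pi>(j)|\<close>. If \<open>A\<close> and \<open>A \<union> {b}\<close> are proper arcs, then \<open>b\<close>
  prolongs \<open>A\<close> at one of its two ends, and the end fixes the orientation of all triples \<open>(a, b, c)\<close>
  with \<open>a\<close> in \<open>A\<close> and \<open>c\<close> outside. Conversely, a neighbour of \<open>b\<close> that lies outside \<open>A\<close> has
  a known orientation with \<open>b\<close> and any \<open>a\<close> in \<open>A\<close>, so that the sign of \<open>\<pi>(j)\<close> forces the other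
  neighbour into \<open>A\<close>.
\<close>

text \<open>The strict cyclic order: going up from \<open>a\<close> around the circle,
  \<open>b\<close> is met before \<open>c\<close>. Rotating the arguments changes nothing, and for
  distinct arguments exactly one of \<open>ccw a b c\<close> and \<open>ccw c b a\<close>
  holds.\<close>

definition ccw :: "int \<Rightarrow> int \<Rightarrow> int \<Rightarrow> bool" where
  "ccw a b c \<longleftrightarrow> a < b \<and> b < c \<or> b < c \<and> c < a \<or> c < a \<and> a < b"

section \<open>Neighbours and arcs in the cyclic order\<close>

lemma cyc_pred: "b \<in> {1..int n} \<Longrightarrow> cyc n (b - 1) = (if b = 1 then int n else b - 1)"
proof -
  assume b: "b \<in> {1..int n}"
  have "(- 1) mod int n = int n - 1" if "b = 1"
    using b that by (simp add: zmod_minus1)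
  then show ?thesis
    using b by (auto simp: cyc_def)
qed

lemma cyc_succ: "b \<in> {1..int n} \<Longrightarrow> cyc n (b + 1) = (if b = int n then 1 else b + 1)"
  by (auto simp: cyc_def)

lemma cyclic_interval_atLeastAtMost:
  "1 \<le> p \<Longrightarrow> p \<le> q \<Longrightarrow> q \<le> int n \<Longrightarrow> cyclic_interval n {p..q}"
  unfolding cyclic_interval_def by blast

lemma cyclic_interval_wrap:
  "1 \<le> p \<Longrightarrow> p \<le> q \<Longrightarrow> q \<le> int n \<Longrightarrow> cyclic_interval n ({q..int n} \<union> {1..p})"
  unfolding cyclic_interval_def by blast

lemma cyclic_interval_singleton: "a \<in> {1..int n} \<Longrightarrow> cyclic_interval n {a}"
  using cyclic_interval_atLeastAtMost[of a a n] by simp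

lemma cyclic_interval_insert_pred:
  assumes "cyclic_interval n A" "b \<in> {1..int n}" "b \<notin> A" "cyc n (b - 1) \<in> A"
  shows "cyclic_interval n (insert b A)"
proof -
  from assms(1) obtain p q where pq: "1 \<le> p" "p \<le> q" "q \<le> int n"
    "A = {p..q} \<or> A = {q..int n} \<union> {1..p}"
    unfolding cyclic_interval_def by blast
  \<comment> \<open>The point \<open>b\<close> prolongs \<open>A\<close> at its upper end: inside
    the range, by passing from \<open>n\<close> to 1, or after a passage that \<open>A\<close> has
    already made.\<close>
  consider "A = {p..q}" "b = q + 1" | "A = {p..q}" "b = 1" "q = int n"
    | "A = {q..int n} \<union> {1..p}" "b = p + 1"
    using pq assms(2-4) unfolding cyc_pred[OF assms(2)] by (auto split: if_splits)
  then show ?thesis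
  proof cases
    case 1
    then have "insert b A = {p..q + 1}" using pq by auto
    moreover have "q + 1 \<le> int n" using 1 assms(2) by simp
    ultimately show ?thesis using cyclic_interval_atLeastAtMost[of p "q + 1" n] pq by simp
  next
    case 2
    then have "insert b A = {p..int n} \<union> {1..1}" using pq by auto
    then show ?thesis using cyclic_interval_wrap[of 1 p n] pq by simp
  next
    case 3
    then have "insert b A = {q..int n} \<union> {1..p + 1}" using pq by auto
    moreover have "p + 1 \<le> q" using 3 assms(2,3) pq by auto
    ultimately show ?thesis using cyclic_interval_wrap[of "p + 1" q n] pq by simp
  qed
qed

lemma cyclic_interval_insert_succ:
  assumes "cyclic_interval n A" "b \<in> {1..int n}" "b \<notin> A" "cyc n (b + 1) \<in> A"
  shows "cyclic_interval n (insert b A)"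
proof -
  from assms(1) obtain p q where pq: "1 \<le> p" "p \<le> q" "q \<le> int n"
    "A = {p..q} \<or> A = {q..int n} \<union> {1..p}"
    unfolding cyclic_interval_def by blast
  consider "A = {p..q}" "b = p - 1" | "A = {p..q}" "b = int n" "p = 1"
    | "A = {q..int n} \<union> {1..p}" "b = q - 1"
    using pq assms(2-4) unfolding cyc_succ[OF assms(2)] by (auto split: if_splits)
  then show ?thesis
  proof cases
    case 1
    then have "insert b A = {p - 1..q}" using pq by auto
    moreover have "1 \<le> p - 1" using 1 assms(2) by simp
    ultimately show ?thesis using cyclic_interval_atLeastAtMost[of "p - 1" q n] pq by simp
  next
    case 2
    then have "insert b A = {int n..int n} \<union> {1..q}" using pq by auto
    then show ?thesis using cyclic_interval_wrap[of q "int n" n] pq by simp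
  next
    case 3
    then have "insert b A = {q - 1..int n} \<union> {1..p}" using pq by auto
    moreover have "p \<le> q - 1" using 3 assms(2,3) pq by auto
    ultimately show ?thesis using cyclic_interval_wrap[of p "q - 1" n] pq by simp
  qed
qed

text \<open>The points \<open>u\<close> and \<open>v\<close> cut the circle into two open arcs, and
  an arc that misses both lies within one of them. Orientations below depend on arcs only through
  this fact.\<close>

lemma cyclic_interval_not_separated:
  assumes "cyclic_interval n A" "x \<in> A" "y \<in> A" "u \<notin> A" "v \<notin> A"
    "u \<in> {1..int n}" "v \<in> {1..int n}" "ccw u x v"
  shows "\<not> ccw v y u"
  using assms unfolding cyclic_interval_def ccw_def by (elim exE conjE disjE) auto

text \<open>Non-separation for \<open>insert b A\<close> puts a neighbour of \<open>b\<close> into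
  \<open>A\<close>; non-separation for \<open>A\<close> then reads the orientation off that
  neighbour.\<close>

lemma cyclic_interval_insert_ccw:
  assumes A: "cyclic_interval n A" "cyclic_interval n (insert b A)" "A \<subseteq> {1..int n}"
    and b: "b \<in> {1..int n}" "b \<notin> A" and c: "c \<in> {1..int n}" "c \<notin> insert b A" and a: "a \<in> A"
  shows "cyc n (b - 1) \<in> A \<and> ccw a b c \<or> cyc n (b + 1) \<in> A \<and> ccw c b a"
proof -
  let ?u = "cyc n (b - 1)" and ?v = "cyc n (b + 1)"
  note u = cyc_pred[OF b(1)] and v = cyc_succ[OF b(1)]
  have a': "a \<in> {1..int n}" "a \<noteq> b" "a \<noteq> c" using A a b c by auto
  \<comment> \<open>Three distinct points \<open>a\<close>, \<open>b\<close>, \<open>c\<close> force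
    \<open>n\<close> to be at least 3, so \<open>b\<close> and its two neighbours are
    distinct.\<close>
  have uv: "?u \<in> {1..int n}" "?v \<in> {1..int n}" "?u \<noteq> b" "?v \<noteq> b" "?u \<noteq> ?v"
    unfolding u v using a' b c by (auto split: if_splits)
  have "?u \<in> A \<or> ?v \<in> A"
  proof (rule ccontr)
    assume *: "\<not> (?u \<in> A \<or> ?v \<in> A)"
    \<comment> \<open>Between its two neighbours lies \<open>b\<close> alone, so they would separate
      it from \<open>a\<close>.\<close>
    have "ccw ?u b ?v" "ccw ?v a ?u"
      using a a' b(1) c * uv unfolding u v ccw_def
      by (auto split: if_splits) (smt (verit))+
    moreover have "?u \<notin> insert b A" "?v \<notin> insert b A" using * uv by auto
    ultimately show False
      using cyclic_interval_not_separated[OF A(2), of b a ?u ?v] uv a by auto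
  qed
  moreover have "ccw a b c" if "?u \<in> A"
  proof (rule ccontr)
    assume n: "\<not> ccw a b c"
    have "?u \<noteq> c" using that c by auto
    \<comment> \<open>The outside points \<open>b\<close> and \<open>c\<close> would separate two
      points of \<open>A\<close>: \<open>?u\<close> lies on the way up from \<open>c\<close> to
      \<open>b\<close>, and \<open>a\<close> on the way up from \<open>b\<close> to
      \<open>c\<close>.\<close>
    then have "ccw c ?u b" using uv(1,3) b c unfolding u ccw_def by (auto split: if_splits)
    moreover have "ccw b a c" using n a' c(2) unfolding ccw_def by auto
    ultimately show False
      using cyclic_interval_not_separated[OF A(1), of a ?u b c] that a b c by auto
  qed
  moreover have "ccw c b a" if "?v \<in> A"
  proof (rule ccontr)
    assume n: "\<not> ccw c b a"
    have "?v \<noteq> c" using that c by auto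
    then have "ccw b ?v c" using uv(2,4) b c unfolding v ccw_def by (auto split: if_splits)
    moreover have "ccw c a b" using n a' c(2) unfolding ccw_def by auto
    ultimately show False
      using cyclic_interval_not_separated[OF A(1), of a ?v c b] that a b c by auto
  qed
  ultimately show ?thesis by blast
qed

section \<open>From pattern avoidance to orientations of triples\<close>

lemma contains_pattern_3:
  "contains_pattern n \<pi> 3 (of_window [x, y, z]) \<longleftrightarrow>
    (\<exists>i j k. 1 \<le> i \<and> i < j \<and> j < k \<and> k \<le> int n \<and>
      sgn (\<pi> i) = sgn x \<and> sgn (\<pi> j) = sgn y \<and> sgn (\<pi> k) = sgn z \<and>
      (\<bar>\<pi> i\<bar> < \<bar>\<pi> j\<bar> \<longleftrightarrow> \<bar>x\<bar> < \<bar>y\<bar>) \<and> (\<bar>\<pi> j\<bar> < \<bar>\<pi> i\<bar> \<longleftrightarrow> \<bar>y\<bar> < \<bar>x\<bar>) \<and>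
      (\<bar>\<pi> i\<bar> < \<bar>\<pi> k\<bar> \<longleftrightarrow> \<bar>x\<bar> < \<bar>z\<bar>) \<and> (\<bar>\<pi> k\<bar> < \<bar>\<pi> i\<bar> \<longleftrightarrow> \<bar>z\<bar> < \<bar>x\<bar>) \<and>
      (\<bar>\<pi> j\<bar> < \<bar>\<pi> k\<bar> \<longleftrightarrow> \<bar>y\<bar> < \<bar>z\<bar>) \<and> (\<bar>\<pi> k\<bar> < \<bar>\<pi> j\<bar> \<longleftrightarrow> \<bar>z\<bar> < \<bar>y\<bar>))"
  (is "?L \<longleftrightarrow> ?R")
proof -
  have S: "{1..int 3} = {1, 2, 3}" by auto
  show ?thesis
  proof
    assume ?L
    then obtain ix :: "int \<Rightarrow> int" where ix: "strict_mono_on {1, 2, 3} ix" "ix ` {1, 2, 3} \<subseteq> {1..int n}"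
      "\<forall>j\<in>{1, 2, 3}. sgn (\<pi> (ix j)) = sgn (of_window [x, y, z] j)"
      "\<forall>j\<in>{1, 2, 3}. \<forall>l\<in>{1, 2, 3}. \<bar>\<pi> (ix j)\<bar> < \<bar>\<pi> (ix l)\<bar> \<longleftrightarrow>
        \<bar>of_window [x, y, z] j\<bar> < \<bar>of_window [x, y, z] l\<bar>"
      unfolding contains_pattern_def S by blast
    have "ix 1 < ix 2" "ix 2 < ix 3"
      using strict_mono_onD[OF ix(1), of 1 2] strict_mono_onD[OF ix(1), of 2 3] by auto
    then show ?R using ix(2-)
      by (intro exI[of _ "ix 1"] exI[of _ "ix 2"] exI[of _ "ix 3"]) (simp add: of_window_3)
  next
    assume ?R
    then obtain i j k where ijk: "1 \<le> i \<and> i < j \<and> j < k \<and> k \<le> int n \<and>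
      sgn (\<pi> i) = sgn x \<and> sgn (\<pi> j) = sgn y \<and> sgn (\<pi> k) = sgn z \<and>
      (\<bar>\<pi> i\<bar> < \<bar>\<pi> j\<bar> \<longleftrightarrow> \<bar>x\<bar> < \<bar>y\<bar>) \<and> (\<bar>\<pi> j\<bar> < \<bar>\<pi> i\<bar> \<longleftrightarrow> \<bar>y\<bar> < \<bar>x\<bar>) \<and>
      (\<bar>\<pi> i\<bar> < \<bar>\<pi> k\<bar> \<longleftrightarrow> \<bar>x\<bar> < \<bar>z\<bar>) \<and> (\<bar>\<pi> k\<bar> < \<bar>\<pi> i\<bar> \<longleftrightarrow> \<bar>z\<bar> < \<bar>x\<bar>) \<and>
      (\<bar>\<pi> j\<bar> < \<bar>\<pi> k\<bar> \<longleftrightarrow> \<bar>y\<bar> < \<bar>z\<bar>) \<and> (\<bar>\<pi> k\<bar> < \<bar>\<pi> j\<bar> \<longleftrightarrow> \<bar>z\<bar> < \<bar>y\<bar>)"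
      by blast
    then have "strict_mono_on {1, 2, 3} (id(1 := i, 2 := j, 3 := k))"
      by (auto simp: strict_mono_on_def)
    then show ?L
      using ijk unfolding contains_pattern_def S
      by (intro exI[of _ "id(1 := i, 2 := j, 3 := k)"]) (simp add: of_window_3)
  qed
qed

text \<open>By oddness, equal absolute values at \<open>i\<close> and \<open>j\<close> mean
  \<open>i = j\<close> or \<open>i = - j\<close>, and positivity excludes the latter. Surjectivity
  follows by finiteness.\<close>

lemma abs_signed_perm:
  assumes "\<pi> \<in> signed_perms n"
  shows abs_signed_perm_bounds: "i \<in> {1..int n} \<Longrightarrow> \<bar>\<pi> i\<bar> \<in> {1..int n}"
    and abs_signed_perm_inj: "inj_on (\<lambda>i. \<bar>\<pi> i\<bar>) {1..int n}"
    and abs_signed_perm_surj: "(\<lambda>i. \<bar>\<pi> i\<bar>) ` {1..int n} = {1..int n}"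
proof -
  have p: "\<pi> permutes pm_set n" and odd: "\<And>a. a \<in> pm_set n \<Longrightarrow> \<pi> (- a) = - \<pi> a"
    using assms by (auto simp: signed_perms_def)
  have B: "\<bar>\<pi> i\<bar> \<in> {1..int n}" if "i \<in> {1..int n}" for i
  proof -
    have "\<pi> i \<in> pm_set n" using permutes_in_image[OF p, of i] that by (auto simp: pm_set_def)
    then show ?thesis by (auto simp: pm_set_def)
  qed
  show I: "inj_on (\<lambda>i. \<bar>\<pi> i\<bar>) {1..int n}"
  proof (rule inj_onI)
    fix i j assume ij: "i \<in> {1..int n}" "j \<in> {1..int n}" "\<bar>\<pi> i\<bar> = \<bar>\<pi> j\<bar>"
    then have "\<pi> i = \<pi> j \<or> \<pi> i = \<pi> (- j)"
      using odd[of j] by (auto simp: pm_set_def abs_eq_iff)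
    then have "i = j \<or> i = - j" using permutes_inj[OF p] by (auto dest: injD)
    then show "i = j" using ij by auto
  qed
  show "(\<lambda>i. \<bar>\<pi> i\<bar>) ` {1..int n} = {1..int n}"
    by (rule endo_inj_surj[OF _ _ I]) (use B in auto)
  show "i \<in> {1..int n} \<Longrightarrow> \<bar>\<pi> i\<bar> \<in> {1..int n}" by (rule B)
qed

text \<open>The patterns run through all six orders of three absolute values, each time giving the
  middle entry the sign opposite to the orientation and leaving the outer signs free.\<close>

lemma avoids_arc_patterns_iff:
  assumes "\<pi> \<in> signed_perms n"
  shows "(\<forall>\<sigma>\<in>arc_patterns. avoids_pattern n \<pi> 3 \<sigma>) \<longleftrightarrow>
    (\<forall>i j k. 1 \<le> i \<and> i < j \<and> j < k \<and> k \<le> int n \<longrightarrow>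
      (\<pi> j > 0 \<longleftrightarrow> ccw (\<bar>\<pi> i\<bar>) (\<bar>\<pi> j\<bar>) (\<bar>\<pi> k\<bar>)))"
  (is "?L \<longleftrightarrow> ?R")
proof
  assume L: ?L
  have av: "avoids_pattern n \<pi> 3 (of_window w)"
    if "s \<in> {1, -1}" "t \<in> {1, -1}" "w \<in> {[s * 1, -2, t * 3], [s * 1, 3, t * 2], [s * 2, -3, t * 1],
      [s * 2, 1, t * 3], [s * 3, -1, t * 2], [s * 3, 2, t * 1]}" for s t w
    using L that unfolding arc_patterns_def by blast
  show ?R
  proof (intro allI impI)
    fix i j k assume ijk: "1 \<le> i \<and> i < j \<and> j < k \<and> k \<le> int n"
    then have r: "i \<in> {1..int n}" "j \<in> {1..int n}" "k \<in> {1..int n}" by auto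
    note inj = inj_onD[OF abs_signed_perm_inj[OF assms]]
    have ne: "\<bar>\<pi> i\<bar> \<noteq> \<bar>\<pi> j\<bar>" "\<bar>\<pi> j\<bar> \<noteq> \<bar>\<pi> k\<bar>" "\<bar>\<pi> i\<bar> \<noteq> \<bar>\<pi> k\<bar>"
      using inj[of i j] inj[of j k] inj[of i k] r ijk by auto
    have nz: "\<pi> i \<noteq> 0" "\<pi> j \<noteq> 0" "\<pi> k \<noteq> 0"
      using abs_signed_perm_bounds[OF assms] r by fastforce+
    \<comment> \<open>Among the four sign choices, this one matches the outer entries of the triple,
      so only the middle sign and the order remain to be compared.\<close>
    define s t where "s = sgn (\<pi> i)" and "t = sgn (\<pi> k)"
    have st: "s \<in> {1, -1}" "t \<in> {1, -1}"
      using nz by (auto simp: s_def t_def sgn_if)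
    have sg: "\<bar>s\<bar> = 1" "\<bar>t\<bar> = 1" "sgn s = s" "sgn t = t" using st by auto
    have no: "\<not> (sgn (\<pi> j) = sgn y \<and>
      (\<bar>\<pi> i\<bar> < \<bar>\<pi> j\<bar> \<longleftrightarrow> x < \<bar>y\<bar>) \<and> (\<bar>\<pi> j\<bar> < \<bar>\<pi> i\<bar> \<longleftrightarrow> \<bar>y\<bar> < x) \<and>
      (\<bar>\<pi> i\<bar> < \<bar>\<pi> k\<bar> \<longleftrightarrow> x < z) \<and> (\<bar>\<pi> k\<bar> < \<bar>\<pi> i\<bar> \<longleftrightarrow> z < x) \<and>
      (\<bar>\<pi> j\<bar> < \<bar>\<pi> k\<bar> \<longleftrightarrow> \<bar>y\<bar> < z) \<and> (\<bar>\<pi> k\<bar> < \<bar>\<pi> j\<bar> \<longleftrightarrow> z < \<bar>y\<bar>))"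
      if "(x, y, z) \<in> {(1, -2, 3), (1, 3, 2), (2, -3, 1), (2, 1, 3), (3, -1, 2), (3, 2, 1)}" for x y z
    proof -
      have xz: "x > 0" "z > 0" using that by auto
      have *: "\<bar>s * x\<bar> = x" "\<bar>t * z\<bar> = z" "sgn (s * x) = sgn (\<pi> i)" "sgn (t * z) = sgn (\<pi> k)"
        using xz sg by (auto simp: abs_mult sgn_mult s_def t_def)
      have "avoids_pattern n \<pi> 3 (of_window [s * x, y, t * z])"
        by (rule av[OF st]) (use that in auto)
      then show ?thesis unfolding contains_pattern_3 * using ijk by blast
    qed
    show "\<pi> j > 0 \<longleftrightarrow> ccw (\<bar>\<pi> i\<bar>) (\<bar>\<pi> j\<bar>) (\<bar>\<pi> k\<bar>)"
    proof (cases "\<pi> j > 0")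
      case True
      then show ?thesis
        using no[of 1 3 2] no[of 2 1 3] no[of 3 2 1] ne unfolding ccw_def by auto
    next
      case False
      then have "sgn (\<pi> j) = -1" using nz by auto
      then show ?thesis using False
        using no[of 1 "-2" 3] no[of 2 "-3" 1] no[of 3 "-1" 2] ne unfolding ccw_def by auto
    qed
  qed
next
  assume R: ?R
  show ?L
  proof (rule ballI, rule notI)
    fix \<sigma> assume "\<sigma> \<in> arc_patterns" and c: "contains_pattern n \<pi> 3 \<sigma>"
    then obtain s t x y z where st: "s \<in> {1, -1}" "t \<in> {1, -1}"
      and \<sigma>: "\<sigma> = of_window [s * x, y, t * z]"
      and xyz: "(x, y, z) \<in> {(1, -2, 3), (1, 3, 2), (2, -3, 1), (2, 1, 3), (3, -1, 2), (3, 2, 1)}"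
      unfolding arc_patterns_def by blast
    have "\<bar>s * x\<bar> = x" "\<bar>t * z\<bar> = z" using st xyz by (auto simp: abs_mult)
    note c[unfolded \<sigma> contains_pattern_3 this]
    then obtain i j k where ijk: "1 \<le> i \<and> i < j \<and> j < k \<and> k \<le> int n"
      and sg: "sgn (\<pi> j) = sgn y"
      and o: "\<bar>\<pi> i\<bar> < \<bar>\<pi> j\<bar> \<longleftrightarrow> x < \<bar>y\<bar>" "\<bar>\<pi> j\<bar> < \<bar>\<pi> i\<bar> \<longleftrightarrow> \<bar>y\<bar> < x"
        "\<bar>\<pi> i\<bar> < \<bar>\<pi> k\<bar> \<longleftrightarrow> x < z" "\<bar>\<pi> k\<bar> < \<bar>\<pi> i\<bar> \<longleftrightarrow> z < x"
        "\<bar>\<pi> j\<bar> < \<bar>\<pi> k\<bar> \<longleftrightarrow> \<bar>y\<bar> < z" "\<bar>\<pi> k\<bar> < \<bar>\<pi> j\<bar> \<longleftrightarrow> z < \<bar>y\<bar>"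
      by blast
    have "\<pi> j > 0 \<longleftrightarrow> y > 0" using sg by (simp add: sgn_if split: if_splits)
    moreover have "\<pi> j > 0 \<longleftrightarrow> ccw (\<bar>\<pi> i\<bar>) (\<bar>\<pi> j\<bar>) (\<bar>\<pi> k\<bar>)" using R ijk by blast
    \<comment> \<open>The pattern has the same order as the triple in \<pi>, hence the same
      orientation; each of the six patterns violates the resulting equivalence.\<close>
    ultimately have "y > 0 \<longleftrightarrow> ccw x \<bar>y\<bar> z"
      unfolding ccw_def o by simp
    then show False using xyz unfolding ccw_def by auto
  qed
qed

section \<open>Arc conditions against orientations of triples\<close>

theorem theorem4p5:
  fixes n :: nat and \<pi> :: "int \<Rightarrow> int"
  assumes "\<pi> \<in> signed_perms n"
  shows "signed_arc_perm n \<pi> \<longleftrightarrow> (\<forall>\<sigma>\<in>arc_patterns. avoids_pattern n \<pi> 3 \<sigma>)"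
  unfolding avoids_arc_patterns_iff[OF assms]
proof
  let ?I = "\<lambda>i. (\<lambda>j. \<bar>\<pi> j\<bar>) ` {1..i}"
  note bd = abs_signed_perm_bounds[OF assms]
  note inj = abs_signed_perm_inj[OF assms]
  have out: "\<bar>\<pi> k\<bar> \<notin> ?I j" if "j < k" "k \<in> {1..int n}" for j k
    using inj_onD[OF inj, of k] that by force
  have sub: "?I j \<subseteq> {1..int n}" if "j \<le> int n" for j
    using bd that by force
  have ins: "?I j = insert \<bar>\<pi> j\<bar> (?I (j - 1))" if "1 \<le> j" for j
  proof -
    have "{1..j} = insert j {1..j - 1}" using that by auto
    then show ?thesis by simp
  qed
  {
    assume arc: "signed_arc_perm n \<pi>"
    \<comment> \<open>The definition speaks of \<open>1 < i\<close> only, but triples with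
      \<open>j = 2\<close> also need the arc consisting of the first value.\<close>
    have int: "cyclic_interval n (?I i)" if "1 \<le> i" "i < int n" for i
    proof (cases "i = 1")
      case True
      then show ?thesis using cyclic_interval_singleton[OF bd[of 1]] that by simp
    next
      case False
      then show ?thesis using arc that unfolding signed_arc_perm_def by simp
    qed
    show "\<forall>i j k. 1 \<le> i \<and> i < j \<and> j < k \<and> k \<le> int n \<longrightarrow>
      (\<pi> j > 0 \<longleftrightarrow> ccw (\<bar>\<pi> i\<bar>) (\<bar>\<pi> j\<bar>) (\<bar>\<pi> k\<bar>))"
    proof (intro allI impI)
      fix i j k assume ijk: "1 \<le> i \<and> i < j \<and> j < k \<and> k \<le> int n"
      let ?A = "?I (j - 1)" and ?b = "\<bar>\<pi> j\<bar>"
      have sgn: "cyc n (?b - 1) \<in> ?A \<longrightarrow> \<pi> j > 0" "cyc n (?b + 1) \<in> ?A \<longrightarrow> \<pi> j < 0"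
        using arc ijk unfolding signed_arc_perm_def by auto
      have "cyc n (?b - 1) \<in> ?A \<and> ccw (\<bar>\<pi> i\<bar>) ?b (\<bar>\<pi> k\<bar>) \<or>
          cyc n (?b + 1) \<in> ?A \<and> ccw (\<bar>\<pi> k\<bar>) ?b (\<bar>\<pi> i\<bar>)"
      proof (rule cyclic_interval_insert_ccw)
        show "cyclic_interval n ?A" "cyclic_interval n (insert ?b ?A)" "\<bar>\<pi> k\<bar> \<notin> insert ?b ?A"
          using int[of "j - 1"] int[of j] ins[of j] out[of j k] ijk by auto
        show "?b \<notin> ?A" using out[of "j - 1" j] ijk by auto
        show "?A \<subseteq> {1..int n}" using sub ijk by auto
      qed (use bd ijk in auto)
      then show "\<pi> j > 0 \<longleftrightarrow> ccw (\<bar>\<pi> i\<bar>) (\<bar>\<pi> j\<bar>) (\<bar>\<pi> k\<bar>)"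
        using sgn unfolding ccw_def by auto
    qed
  next
    assume R: "\<forall>i j k. 1 \<le> i \<and> i < j \<and> j < k \<and> k \<le> int n \<longrightarrow>
      (\<pi> j > 0 \<longleftrightarrow> ccw (\<bar>\<pi> i\<bar>) (\<bar>\<pi> j\<bar>) (\<bar>\<pi> k\<bar>))"
    \<comment> \<open>Exactly one neighbour occurs earlier, and the sign tells which. This yields
      both the sign condition and the growth of the arc.\<close>
    have nbr: "(cyc n (\<bar>\<pi> j\<bar> - 1) \<in> ?I (j - 1) \<longleftrightarrow> \<pi> j > 0) \<and>
        (cyc n (\<bar>\<pi> j\<bar> + 1) \<in> ?I (j - 1) \<longleftrightarrow> \<not> \<pi> j > 0)" if j: "1 < j" "j < int n" for j
    proof -
      let ?A = "?I (j - 1)" and ?b = "\<bar>\<pi> j\<bar>"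
      have b: "?b \<in> {1..int n}" using bd j by auto
      note u = cyc_pred[OF b] and v = cyc_succ[OF b]
      \<comment> \<open>The hypothesis in terms of values: by surjectivity, a value that is neither
        \<open>?b\<close> nor in \<open>?A\<close> occurs after position \<open>j\<close>.\<close>
      have ccw: "\<pi> j > 0 \<longleftrightarrow> ccw a ?b c" if "a \<in> ?A" "c \<in> {1..int n}" "c \<notin> ?A" "c \<noteq> ?b" for a c
      proof -
        obtain i where i: "i \<in> {1..j - 1}" "a = \<bar>\<pi> i\<bar>" using \<open>a \<in> ?A\<close> by blast
        obtain k where k: "k \<in> {1..int n}" "c = \<bar>\<pi> k\<bar>"
          using \<open>c \<in> {1..int n}\<close> abs_signed_perm_surj[OF assms] by (metis (no_types, lifting) imageE)
        have "k \<notin> {1..j - 1}" "k \<noteq> j" using that k by auto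
        then have "j < k" using k by auto
        then show ?thesis using R i k by auto
      qed
      \<comment> \<open>Since \<open>1 < j < n\<close>, the first and the last value serve as a
        sample earlier and a sample later value.\<close>
      have a0: "\<bar>\<pi> 1\<bar> \<in> ?A" using j by auto
      have c0: "\<bar>\<pi> (int n)\<bar> \<in> {1..int n}" "\<bar>\<pi> (int n)\<bar> \<notin> ?A" "\<bar>\<pi> (int n)\<bar> \<noteq> ?b"
        using bd[of "int n"] out[of j "int n"] ins[of j] j by auto
      have "?b \<notin> ?A" using out[of "j - 1" j] j by auto
      then have a0': "\<bar>\<pi> 1\<bar> \<in> {1..int n}" "\<bar>\<pi> 1\<bar> \<noteq> ?b"
        using bd[of 1] j a0 by (simp, metis)
      have uv: "cyc n (?b - 1) \<in> {1..int n}" "cyc n (?b + 1) \<in> {1..int n}"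
        "cyc n (?b - 1) \<noteq> ?b" "cyc n (?b + 1) \<noteq> ?b"
        unfolding u v using b j by (auto split: if_splits)
      \<comment> \<open>No value lies strictly between \<open>?b\<close> and a neighbour, so the
        neighbour's orientation with any third value is known. In 1 and 2 the neighbour is the
        earlier value of the triple, in 3 and 4 the later one.\<close>
      have 1: "\<pi> j > 0" if "cyc n (?b - 1) \<in> ?A"
      proof -
        have "cyc n (?b - 1) \<noteq> \<bar>\<pi> (int n)\<bar>" using that c0 by auto
        then have "ccw (cyc n (?b - 1)) ?b (\<bar>\<pi> (int n)\<bar>)"
          using c0(1,3) b unfolding u ccw_def by (auto split: if_splits)
        then show ?thesis using ccw[OF that c0] by blast
      qed
      have 2: "\<not> \<pi> j > 0" if "cyc n (?b + 1) \<in> ?A"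
      proof -
        have "\<not> ccw (cyc n (?b + 1)) ?b (\<bar>\<pi> (int n)\<bar>)"
          using c0(1,3) b unfolding v ccw_def by (auto split: if_splits)
        then show ?thesis using ccw[OF that c0] by blast
      qed
      have 3: "\<not> \<pi> j > 0" if "cyc n (?b - 1) \<notin> ?A"
      proof -
        have "\<not> ccw (\<bar>\<pi> 1\<bar>) ?b (cyc n (?b - 1))"
          using a0' b unfolding u ccw_def by (auto split: if_splits)
        then show ?thesis using ccw[OF a0 uv(1) that uv(3)] by blast
      qed
      have 4: "\<pi> j > 0" if "cyc n (?b + 1) \<notin> ?A"
      proof -
        have "cyc n (?b + 1) \<noteq> \<bar>\<pi> 1\<bar>" using that a0 by auto
        then have "ccw (\<bar>\<pi> 1\<bar>) ?b (cyc n (?b + 1))"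
          using a0' b unfolding v ccw_def by (auto split: if_splits)
        then show ?thesis using ccw[OF a0 uv(2) that uv(4)] by blast
      qed
      show ?thesis using 1 2 3 4 by blast
    qed
    \<comment> \<open>Each new value has a neighbour among the earlier ones, by \<open>nbr\<close>,
      and so prolongs the arc. The bound \<open>i < int n\<close> keeps within the range of
      \<open>nbr\<close>.\<close>
    have int: "i < int n \<longrightarrow> cyclic_interval n (?I i)" if "1 \<le> i" for i
      using that
    proof (induction i rule: int_ge_induct)
      case base
      then show ?case using cyclic_interval_singleton[OF bd[of 1]] by simp
    next
      case (step i)
      show ?case
      proof
        assume i: "i + 1 < int n"
        then have A: "cyclic_interval n (?I i)" using step by simp
        have b: "\<bar>\<pi> (i + 1)\<bar> \<in> {1..int n}" "\<bar>\<pi> (i + 1)\<bar> \<notin> ?I i"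
          using bd[of "i + 1"] out[of i "i + 1"] step i by auto
        have "cyc n (\<bar>\<pi> (i + 1)\<bar> - 1) \<in> ?I i \<or> cyc n (\<bar>\<pi> (i + 1)\<bar> + 1) \<in> ?I i"
          using nbr[of "i + 1"] step i by auto
        then have "cyclic_interval n (insert \<bar>\<pi> (i + 1)\<bar> (?I i))"
          using cyclic_interval_insert_pred[OF A b] cyclic_interval_insert_succ[OF A b] by blast
        then show "cyclic_interval n (?I (i + 1))" using ins[of "i + 1"] step by simp
      qed
    qed
    \<comment> \<open>This turns the failure of \<open>\<pi> j > 0\<close> in \<open>nbr\<close>
      into the negative sign that the definition asks for.\<close>
    have "\<pi> j \<noteq> 0" if "1 < j" "j < int n" for j using bd[of j] that by auto
    then show "signed_arc_perm n \<pi>"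
      unfolding signed_arc_perm_def using assms int nbr by (auto simp: not_less order_le_less)
  }
qed

end
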